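(* Let $f:G_1\to G_2$ be a graph homomorphism. Then the map $H(f):H(\mathcal{G}_1)\to H(\mathcal{G}_2)$ is an algebra morphism.
   Context: $\mathbf{k}$ is a unitary commutative ring. Graphs are connected, undirected, without multiple edges and loops, with vertices labelled by natural numbers. For a graph $G_i$, $\mathcal{G}_i$ is the set of nonempty connected subgraphs of $G_i$ (a subgraph is a graph all of whose vertices lie in $V(G_i)$ and all of whose edges lie in $E(G_i)$). $M(\mathcal{G}_i)$ is the free monoid on $\mathcal{G}_i$ under concatenation, with unit the empty graph $\mathbf{1}_{G_i}$, and $H(\mathcal{G}_i)=\mathbf{k}M(\mathcal{G}_i)$ is the free $\mathbf{k}$-module on $M(\mathcal{G}_i)$ with concatenation extended linearly; it is the free $\mathbf{k}$-algebra on $\mathcal{G}_i$. A graph homomorphism $f:G_1\to G_2$ is a map $f:V(G_1)\to V(G_2)$ such that $(f(u),f(v))\in E(G_2)$ whenever $(u,v)\in E(G_1)$. For a subgraph $\Gamma$ of $G_1$, $f(\Gamma)$ denotes its image, the subgraph of $G_2$ with vertex set $f(V(\Gamma))$ and edges $(f(u),f(v))$ for $(u,v)\in E(\Gamma)$. The linear map $H(f)$ is defined by $H(f)(\mathbf{1}_{G_1})=\mathbf{1}_{G_2}$ and $H(f)(\Gamma_1\cdots\Gamma_n)=f(\Gamma_1)\cdots f(\Gamma_n)$ for $\Gamma_1,\dots,\Gamma_n\in\mathcal{G}_1$, $n\ge1$. Algebra morphisms preserve products and units. *)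

theory Defs
  imports "HOL-Algebra.Module" "Graph_Theory.Digraph_Component"
begin

text \<open>
  Undirected graphs without loops and multiple edges are the symmetric loop-free digraphs whose
  arcs are pairs (\<open>pair_bidirected_digraph\<close>): an edge between \<open>u\<close> and \<open>v\<close> is represented by the
  two arcs \<open>(u, v)\<close> and \<open>(v, u)\<close>. Finiteness is not required.
  The library's \<open>connected\<close> implies that there is a vertex; the empty graph is admitted
  as an ambient graph, but not as a generator.
\<close>

definition connected_graph :: "'v pair_pre_digraph \<Rightarrow> bool" where
  "connected_graph G \<longleftrightarrow>
     pair_bidirected_digraph G \<and>
     (pverts G = {} \<or> Digraph_Component.connected (with_proj G))"

definition connected_subgraphs :: "'v pair_pre_digraph \<Rightarrow> 'v pair_pre_digraph set" where
  "connected_subgraphs G =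
     {\<Gamma>. pair_bidirected_digraph \<Gamma> \<and> subgraph (with_proj \<Gamma>) (with_proj G) \<and>
         pverts \<Gamma> \<noteq> {} \<and> Digraph_Component.connected (with_proj \<Gamma>)}"

definition graph_hom :: "'v pair_pre_digraph \<Rightarrow> 'w pair_pre_digraph \<Rightarrow> ('v \<Rightarrow> 'w) set" where
  "graph_hom G1 G2 =
     {f \<in> pverts G1 \<rightarrow> pverts G2. \<forall>(u, v) \<in> parcs G1. (f u, f v) \<in> parcs G2}"

definition graph_image :: "('v \<Rightarrow> 'w) \<Rightarrow> 'v pair_pre_digraph \<Rightarrow> 'w pair_pre_digraph" where
  "graph_image f \<Gamma> =
     \<lparr>pverts = f ` pverts \<Gamma>, parcs = (\<lambda>(u, v). (f u, f v)) ` parcs \<Gamma>\<rparr>"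

text \<open>
  The free \<open>R\<close>-algebra on a set \<open>S\<close>: the free monoid on \<open>S\<close> is \<open>lists S\<close> with concatenation and
  unit \<open>[]\<close>, and an element of its linear span is the function giving the coefficient of each
  word. The product is the bilinear extension of concatenation, so the coefficient of \<open>w\<close> in
  a product is a sum over the (finitely many) factorizations of \<open>w\<close>.
\<close>

definition word_basis :: "('k, 'm) ring_scheme \<Rightarrow> 'g list \<Rightarrow> 'g list \<Rightarrow> 'k" where
  "word_basis R w = (\<lambda>u. if u = w then \<one>\<^bsub>R\<^esub> else \<zero>\<^bsub>R\<^esub>)"

definition free_algebra ::
    "('k, 'm) ring_scheme \<Rightarrow> 'g set \<Rightarrow> ('k, 'g list \<Rightarrow> 'k) module" where
  "free_algebra R S =
     \<lparr>carrier = {x. (\<forall>w. x w \<in> carrier R) \<and> (\<forall>w. w \<notin> lists S \<longrightarrow> x w = \<zero>\<^bsub>R\<^esub>) \<and>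
                    finite {w. x w \<noteq> \<zero>\<^bsub>R\<^esub>}},
      monoid.mult = (\<lambda>x y w. \<Oplus>\<^bsub>R\<^esub>p \<in> {(u, v). u @ v = w}. x (fst p) \<otimes>\<^bsub>R\<^esub> y (snd p)),
      one = word_basis R [],
      zero = (\<lambda>w. \<zero>\<^bsub>R\<^esub>),
      add = (\<lambda>x y w. x w \<oplus>\<^bsub>R\<^esub> y w),
      smult = (\<lambda>a x w. a \<otimes>\<^bsub>R\<^esub> x w)\<rparr>"

text \<open>
  The locale \<open>algebra\<close> of the library is about commutative algebras.
\<close>

locale assoc_algebra = Module.module R A + ring A for R (structure) and A (structure) +
  assumes smult_mult_left:
      "\<lbrakk>a \<in> carrier R; x \<in> carrier A; y \<in> carrier A\<rbrakk> \<Longrightarrow>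
       (a \<odot>\<^bsub>A\<^esub> x) \<otimes>\<^bsub>A\<^esub> y = a \<odot>\<^bsub>A\<^esub> (x \<otimes>\<^bsub>A\<^esub> y)"
    and smult_mult_right:
      "\<lbrakk>a \<in> carrier R; x \<in> carrier A; y \<in> carrier A\<rbrakk> \<Longrightarrow>
       x \<otimes>\<^bsub>A\<^esub> (a \<odot>\<^bsub>A\<^esub> y) = a \<odot>\<^bsub>A\<^esub> (x \<otimes>\<^bsub>A\<^esub> y)"

definition algebra_morphism ::
    "('k, 'm) ring_scheme \<Rightarrow> ('k, 'a, 'p) module_scheme \<Rightarrow> ('k, 'b, 'q) module_scheme \<Rightarrow>
     ('a \<Rightarrow> 'b) \<Rightarrow> bool" where
  "algebra_morphism R A B h \<longleftrightarrow>
     assoc_algebra R A \<and> assoc_algebra R B \<and> h \<in> ring_hom A B \<and>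
     (\<forall>a \<in> carrier R. \<forall>x \<in> carrier A. h (a \<odot>\<^bsub>A\<^esub> x) = a \<odot>\<^bsub>B\<^esub> h x)"

definition H_alg ::
    "('k, 'm) ring_scheme \<Rightarrow> 'v pair_pre_digraph \<Rightarrow>
     ('k, 'v pair_pre_digraph list \<Rightarrow> 'k) module" where
  "H_alg R G = free_algebra R (connected_subgraphs G)"

text \<open>
  The linear extension of \<open>\<Gamma>\<^sub>1 \<cdots> \<Gamma>\<^sub>n \<mapsto> f(\<Gamma>\<^sub>1) \<cdots> f(\<Gamma>\<^sub>n)\<close>, the case \<open>n = 0\<close> being the
  condition on the units. The target graph is needed only to name the module in which the sum
  is taken.
\<close>

definition H_map ::
    "('k, 'm) ring_scheme \<Rightarrow> 'w pair_pre_digraph \<Rightarrow> ('v \<Rightarrow> 'w) \<Rightarrow>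
     ('v pair_pre_digraph list \<Rightarrow> 'k) \<Rightarrow> 'w pair_pre_digraph list \<Rightarrow> 'k" where
  "H_map R G2 f x =
     (\<Oplus>\<^bsub>H_alg R G2\<^esub>w \<in> {w. x w \<noteq> \<zero>\<^bsub>R\<^esub>}.
        x w \<odot>\<^bsub>H_alg R G2\<^esub> word_basis R (map (graph_image f) w))"

end

theory Submission
  imports Defs
begin

text \<open>
  By its universal property the free algebra sends every monoid homomorphism from words to an
  algebra to an algebra morphism, so all that concerns graphs is that the image of a connected
  subgraph is again a connected subgraph. Since all the operations are additive in each argument,
  the identities involved (associativity, units, multiplicativity) need only be checked on
  monomials, where the convolution product is concatenation.
\<close>

section \<open>Images of connected subgraphs\<close>

lemma graph_image_simps [simp]:
  "pverts (graph_image f \<Gamma>) = f ` pverts \<Gamma>"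
  "parcs (graph_image f \<Gamma>) = (\<lambda>(u, v). (f u, f v)) ` parcs \<Gamma>"
  by (simp_all add: graph_image_def)

text \<open>The walk is carried over arc by arc; it stays in the image of \<open>V\<close> because
  every vertex that it visits lies in \<open>V\<close>.\<close>

lemma rtrancl_on_image:
  assumes "(u, v) \<in> rtrancl_on V E"
    and "\<And>x y. (x, y) \<in> E \<Longrightarrow> (f x, f y) \<in> E'"
  shows "(f u, f v) \<in> rtrancl_on (f ` V) E'"
  using assms(1) by induct (auto intro: converse_rtrancl_on_into_rtrancl_on assms(2))

text \<open>Connectedness is strong connectedness of the symmetrized digraph. Symmetrization
  commutes with taking images of arcs, so a walk between two vertices yields a walk between their
  images.\<close>

lemma connected_graph_image:
  assumes "Digraph_Component.connected (with_proj \<Gamma>)"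
  shows "Digraph_Component.connected (with_proj (graph_image f \<Gamma>))"
proof -
  let ?E = "parcs (mk_symmetric (with_proj \<Gamma>))"
  let ?E' = "parcs (mk_symmetric (with_proj (graph_image f \<Gamma>)))"
  have "(f x, f y) \<in> ?E'" if "(x, y) \<in> ?E" for x y
    using that by (force simp: parcs_mk_symmetric)
  then have "(f u, f v) \<in> rtrancl_on (f ` pverts \<Gamma>) ?E'"
    if "(u, v) \<in> rtrancl_on (pverts \<Gamma>) ?E" for u v
    using that by (rule rtrancl_on_image[rotated])
  then show ?thesis
    using assms
    by (auto simp: Digraph_Component.connected_def strongly_connected_def reachable_def)
qed

text \<open>Loop-freeness of the image comes from the ambient target graph.\<close>

lemma graph_image_connected_subgraphs:
  assumes "connected_graph G2" "f \<in> graph_hom G1 G2" "\<Gamma> \<in> connected_subgraphs G1"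
  shows "graph_image f \<Gamma> \<in> connected_subgraphs G2"
proof -
  interpret G2: pair_bidirected_digraph G2
    using assms(1) by (simp add: connected_graph_def)
  interpret \<Gamma>: pair_bidirected_digraph \<Gamma>
    using assms(3) by (simp add: connected_subgraphs_def)
  have sub: "pverts \<Gamma> \<subseteq> pverts G1" "parcs \<Gamma> \<subseteq> parcs G1"
    using assms(3) by (auto simp: connected_subgraphs_def subgraph_def)
  have verts: "f ` pverts \<Gamma> \<subseteq> pverts G2"
    using sub assms(2) by (auto simp: graph_hom_def)
  have arcs: "(f u, f v) \<in> parcs G2" if "(u, v) \<in> parcs \<Gamma>" for u v
    using that sub assms(2) by (auto simp: graph_hom_def)
  have sym: "(v, u) \<in> parcs \<Gamma>" if "(u, v) \<in> parcs \<Gamma>" for u v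
    using that \<Gamma>.pair_sym_arcs by (auto simp: symmetric_def dest: symD)
  have bidir: "pair_bidirected_digraph (graph_image f \<Gamma>)"
  proof
    fix e assume "e \<in> parcs (graph_image f \<Gamma>)"
    then obtain u v where e: "e = (f u, f v)" "(u, v) \<in> parcs \<Gamma>"
      by auto
    then show "fst e \<in> pverts (graph_image f \<Gamma>)" "snd e \<in> pverts (graph_image f \<Gamma>)"
      by (auto dest: \<Gamma>.wellformed')
    show "fst e \<noteq> snd e"
      using e arcs G2.pair_no_loops by fastforce
  next
    show "symmetric (with_proj (graph_image f \<Gamma>))"
      by (force simp: symmetric_def sym_def dest: sym)
  qed
  then interpret I: pair_bidirected_digraph "graph_image f \<Gamma>" .
  have "subgraph (with_proj (graph_image f \<Gamma>)) (with_proj G2)"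
    unfolding subgraph_def
    using verts arcs G2.wf_digraph_axioms I.wf_digraph_axioms by auto
  then show ?thesis
    using assms(3) bidir by (simp add: connected_subgraphs_def connected_graph_image)
qed


section \<open>The free algebra\<close>

text \<open>With the coefficient built in, every element is a sum of such functions, so an induction
  over the free algebra needs no case for scalar multiples.\<close>

definition monomial :: "('k, 'm) ring_scheme \<Rightarrow> 'k \<Rightarrow> 'g list \<Rightarrow> 'g list \<Rightarrow> 'k" where
  "monomial R a w = (\<lambda>u. if u = w then a else \<zero>\<^bsub>R\<^esub>)"

lemma word_basis_eq_monomial: "word_basis R w = monomial R \<one>\<^bsub>R\<^esub> w"
  by (simp add: word_basis_def monomial_def)

text \<open>A factorization of \<open>w\<close> is determined by the length of its first
  factor.\<close>

lemma finite_factorizations: "finite {(u, v). u @ v = w}"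
proof -
  have "p \<in> (\<lambda>i. (take i w, drop i w)) ` {..length w}" if "p \<in> {(u, v). u @ v = w}" for p
    using that by (intro image_eqI[of _ _ "length (fst p)"]) auto
  then have "{(u, v). u @ v = w} \<subseteq> (\<lambda>i. (take i w, drop i w)) ` {..length w}"
    by blast
  then show ?thesis
    by (rule finite_subset) simp
qed

context cring
begin

section \<open>Coefficientwise operations, closure of the carrier, generation by monomials\<close>

lemma free_algebra_ops:
  "\<one>\<^bsub>free_algebra R S\<^esub> = word_basis R []"
  "\<zero>\<^bsub>free_algebra R S\<^esub> = (\<lambda>w. \<zero>)"
  "x \<oplus>\<^bsub>free_algebra R S\<^esub> y = (\<lambda>w. x w \<oplus> y w)"
  "a \<odot>\<^bsub>free_algebra R S\<^esub> x = (\<lambda>w. a \<otimes> x w)"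
  "x \<otimes>\<^bsub>free_algebra R S\<^esub> y =
    (\<lambda>w. \<Oplus>p\<in>{(u, v). u @ v = w}. x (fst p) \<otimes> y (snd p))"
  by (simp_all add: free_algebra_def)

lemma free_algebra_carrier_iff:
  "x \<in> carrier (free_algebra R S) \<longleftrightarrow>
    (\<forall>w. x w \<in> carrier R) \<and> (\<forall>w. w \<notin> lists S \<longrightarrow> x w = \<zero>) \<and> finite {w. x w \<noteq> \<zero>}"
  by (simp add: free_algebra_def)

lemma free_algebra_coeff [simp]:
  "x \<in> carrier (free_algebra R S) \<Longrightarrow> x w \<in> carrier R"
  by (simp add: free_algebra_carrier_iff)

lemma free_algebra_add_closed:
  assumes "x \<in> carrier (free_algebra R S)" "y \<in> carrier (free_algebra R S)"
  shows "x \<oplus>\<^bsub>free_algebra R S\<^esub> y \<in> carrier (free_algebra R S)"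
proof -
  have "{w. x w \<oplus> y w \<noteq> \<zero>} \<subseteq> {w. x w \<noteq> \<zero>} \<union> {w. y w \<noteq> \<zero>}"
    by auto
  then show ?thesis
    using assms by (auto simp: free_algebra_carrier_iff free_algebra_ops elim: finite_subset)
qed

lemma free_algebra_smult_closed:
  assumes "a \<in> carrier R" "x \<in> carrier (free_algebra R S)"
  shows "a \<odot>\<^bsub>free_algebra R S\<^esub> x \<in> carrier (free_algebra R S)"
proof -
  have "{w. a \<otimes> x w \<noteq> \<zero>} \<subseteq> {w. x w \<noteq> \<zero>}"
    using assms(1) by auto
  then show ?thesis
    using assms by (auto simp: free_algebra_carrier_iff free_algebra_ops elim: finite_subset)
qed

text \<open>A nonzero coefficient of the product needs a nonzero summand, so its word is a
  concatenation of a word from each support. This bounds the support by a finite set and keeps it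
  inside \<open>lists S\<close>.\<close>

lemma free_algebra_mult_closed:
  assumes "x \<in> carrier (free_algebra R S)" "y \<in> carrier (free_algebra R S)"
  shows "x \<otimes>\<^bsub>free_algebra R S\<^esub> y \<in> carrier (free_algebra R S)"
proof -
  let ?m = "\<lambda>w. \<Oplus>p\<in>{(u, v). u @ v = w}. x (fst p) \<otimes> y (snd p)"
  have nz: "\<exists>u v. w = u @ v \<and> x u \<noteq> \<zero> \<and> y v \<noteq> \<zero>" if "?m w \<noteq> \<zero>" for w
  proof (rule ccontr)
    assume "\<nexists>u v. w = u @ v \<and> x u \<noteq> \<zero> \<and> y v \<noteq> \<zero>"
    then have none: "x u = \<zero> \<or> y v = \<zero>" if "u @ v = w" for u v
      using that by blast
    have "?m w = \<zero>"
    proof (rule add.finprod_one_eqI)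
      fix p assume "p \<in> {(u, v). u @ v = w}"
      then have "x (fst p) = \<zero> \<or> y (snd p) = \<zero>"
        using none[of "fst p" "snd p"] by auto
      then show "x (fst p) \<otimes> y (snd p) = \<zero>"
        using assms by auto
    qed
    with that show False by simp
  qed
  have "{w. ?m w \<noteq> \<zero>} \<subseteq> (\<lambda>(u, v). u @ v) ` ({w. x w \<noteq> \<zero>} \<times> {w. y w \<noteq> \<zero>})"
    using nz by fastforce
  moreover have "finite \<dots>"
    using assms by (simp add: free_algebra_carrier_iff)
  ultimately have "finite {w. ?m w \<noteq> \<zero>}"
    by (rule finite_subset)
  moreover have "?m w = \<zero>" if "w \<notin> lists S" for w
    using nz[of w] that assms by (fastforce simp: free_algebra_carrier_iff)
  moreover have "?m w \<in> carrier R" for w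
    using assms by (auto intro!: finsum_closed)
  ultimately show ?thesis
    by (simp add: free_algebra_carrier_iff free_algebra_ops)
qed

lemma monomial_closed:
  assumes "a \<in> carrier R" "w \<in> lists S"
  shows "monomial R a w \<in> carrier (free_algebra R S)"
proof -
  have "{u. monomial R a w u \<noteq> \<zero>} \<subseteq> {w}"
    by (auto simp: monomial_def)
  then have "finite {u. monomial R a w u \<noteq> \<zero>}"
    by (rule finite_subset) simp
  then show ?thesis
    using assms by (auto simp: free_algebra_carrier_iff monomial_def)
qed

text \<open>Addition and scalar multiplication act on each coefficient separately, so the module
  laws are those of \<open>R\<close>; the finite support matters only for closure.\<close>

lemma free_algebra_module: "Module.module R (free_algebra R S)"
proof (rule moduleI)
  show "abelian_group (free_algebra R S)"
  proof (rule abelian_groupI)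
    fix x assume x: "x \<in> carrier (free_algebra R S)"
    have "{w. \<ominus> x w \<noteq> \<zero>} \<subseteq> {w. x w \<noteq> \<zero>}"
      by auto
    then have "(\<lambda>w. \<ominus> x w) \<in> carrier (free_algebra R S)"
      using x by (auto simp: free_algebra_carrier_iff elim: finite_subset)
    moreover have "(\<lambda>w. \<ominus> x w) \<oplus>\<^bsub>free_algebra R S\<^esub> x = \<zero>\<^bsub>free_algebra R S\<^esub>"
      using x by (simp add: free_algebra_ops l_neg)
    ultimately show "\<exists>y\<in>carrier (free_algebra R S). y \<oplus>\<^bsub>free_algebra R S\<^esub> x = \<zero>\<^bsub>free_algebra R S\<^esub>"
      by blast
  next
    show "\<zero>\<^bsub>free_algebra R S\<^esub> \<in> carrier (free_algebra R S)"
      by (simp add: free_algebra_ops free_algebra_carrier_iff)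
  qed (simp_all add: free_algebra_add_closed, simp_all add: free_algebra_ops a_ac)
qed (simp_all add: is_cring free_algebra_smult_closed,
     simp_all add: free_algebra_ops l_distr r_distr m_assoc)

text \<open>Induction on a finite set containing the support: deleting one word from it splits off
  one monomial.\<close>

lemma free_algebra_induct [consumes 1, case_names monomial add]:
  assumes "x \<in> carrier (free_algebra R S)"
    and mono: "\<And>a w. a \<in> carrier R \<Longrightarrow> w \<in> lists S \<Longrightarrow> P (monomial R a w)"
    and add: "\<And>x y. x \<in> carrier (free_algebra R S) \<Longrightarrow> y \<in> carrier (free_algebra R S) \<Longrightarrow>
      P x \<Longrightarrow> P y \<Longrightarrow> P (x \<oplus>\<^bsub>free_algebra R S\<^esub> y)"
  shows "P x"
proof -
  \<comment> \<open>\<open>W\<close> need only contain the support, so the induction hypothesis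
    applies even when the coefficient at the deleted word was already zero.\<close>
  have "P x" if "finite W" "W \<subseteq> lists S" "x \<in> carrier (free_algebra R S)" "{w. x w \<noteq> \<zero>} \<subseteq> W"
    for x W
    using that
  proof (induction W arbitrary: x rule: finite_induct)
    case empty
    \<comment> \<open>The zero element counts as a monomial with coefficient \<open>\<zero>\<close>.
      The empty word serves because it lies in \<open>lists S\<close> for every
      \<open>S\<close>.\<close>
    then have "x = monomial R \<zero> []"
      by (auto simp: monomial_def)
    then show ?case
      using mono[of \<zero> "[]"] by simp
  next
    case (insert w W)
    let ?m = "monomial R (x w) w" and ?y = "x(w := \<zero>)"
    have "finite {u. ?y u \<noteq> \<zero>}"
      by (rule finite_subset[of _ "{u. x u \<noteq> \<zero>}"])
        (use insert.prems(2) in \<open>auto simp: free_algebra_carrier_iff\<close>)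
    then have y: "?y \<in> carrier (free_algebra R S)"
      using insert.prems(2) by (simp add: free_algebra_carrier_iff)
    have "P ?y"
      using insert.prems by (intro insert.IH y) auto
    moreover have "x = ?m \<oplus>\<^bsub>free_algebra R S\<^esub> ?y"
      using insert.prems(2) by (auto simp: free_algebra_ops monomial_def)
    moreover have "?m \<in> carrier (free_algebra R S)" "P ?m"
      using insert.prems by (auto intro: monomial_closed mono)
    ultimately show ?case
      using add y by metis
  qed
  from this[of "{w. x w \<noteq> \<zero>}" x] assms(1) show ?thesis
    by (auto simp: free_algebra_carrier_iff)
qed

section \<open>Bilinearity of the product and its value on monomials\<close>

lemma free_algebra_l_distr:
  assumes "x \<in> carrier (free_algebra R S)" "y \<in> carrier (free_algebra R S)"
    "z \<in> carrier (free_algebra R S)"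
  shows "(x \<oplus>\<^bsub>free_algebra R S\<^esub> y) \<otimes>\<^bsub>free_algebra R S\<^esub> z =
    x \<otimes>\<^bsub>free_algebra R S\<^esub> z \<oplus>\<^bsub>free_algebra R S\<^esub> y \<otimes>\<^bsub>free_algebra R S\<^esub> z"
  using assms by (auto simp: free_algebra_ops l_distr Pi_def simp flip: finsum_addf cong: finsum_cong)

lemma free_algebra_r_distr:
  assumes "x \<in> carrier (free_algebra R S)" "y \<in> carrier (free_algebra R S)"
    "z \<in> carrier (free_algebra R S)"
  shows "z \<otimes>\<^bsub>free_algebra R S\<^esub> (x \<oplus>\<^bsub>free_algebra R S\<^esub> y) =
    z \<otimes>\<^bsub>free_algebra R S\<^esub> x \<oplus>\<^bsub>free_algebra R S\<^esub> z \<otimes>\<^bsub>free_algebra R S\<^esub> y"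
  using assms by (auto simp: free_algebra_ops r_distr Pi_def simp flip: finsum_addf cong: finsum_cong)

text \<open>The scalar passes through the finite sum over factorizations; in the second identity,
  commutativity of \<open>R\<close> moves it past the coefficient of \<open>x\<close>.\<close>

lemma
  assumes "a \<in> carrier R" "x \<in> carrier (free_algebra R S)" "y \<in> carrier (free_algebra R S)"
  shows free_algebra_smult_mult_left:
      "(a \<odot>\<^bsub>free_algebra R S\<^esub> x) \<otimes>\<^bsub>free_algebra R S\<^esub> y =
        a \<odot>\<^bsub>free_algebra R S\<^esub> (x \<otimes>\<^bsub>free_algebra R S\<^esub> y)"
    and free_algebra_smult_mult_right:
      "x \<otimes>\<^bsub>free_algebra R S\<^esub> (a \<odot>\<^bsub>free_algebra R S\<^esub> y) =
        a \<odot>\<^bsub>free_algebra R S\<^esub> (x \<otimes>\<^bsub>free_algebra R S\<^esub> y)"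
proof -
  have "a \<otimes> (\<Oplus>p\<in>{(u, v). u @ v = w}. x (fst p) \<otimes> y (snd p)) =
      (\<Oplus>p\<in>{(u, v). u @ v = w}. a \<otimes> (x (fst p) \<otimes> y (snd p)))" for w
    using assms by (intro finsum_rdistr finite_factorizations) auto
  then show "(a \<odot>\<^bsub>free_algebra R S\<^esub> x) \<otimes>\<^bsub>free_algebra R S\<^esub> y =
      a \<odot>\<^bsub>free_algebra R S\<^esub> (x \<otimes>\<^bsub>free_algebra R S\<^esub> y)"
    and "x \<otimes>\<^bsub>free_algebra R S\<^esub> (a \<odot>\<^bsub>free_algebra R S\<^esub> y) =
      a \<odot>\<^bsub>free_algebra R S\<^esub> (x \<otimes>\<^bsub>free_algebra R S\<^esub> y)"
    using assms by (simp_all add: free_algebra_ops m_assoc m_lcomm Pi_def cong: finsum_cong)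
qed

text \<open>Among all factorizations only the pair \<open>(u, v)\<close> has a possibly nonzero
  summand, and it is a factorization of \<open>w\<close> exactly when
  \<open>w = u @ v\<close>.\<close>

lemma monomial_mult:
  fixes u v :: "'g list"
  assumes "a \<in> carrier R" "b \<in> carrier R"
  shows "monomial R a u \<otimes>\<^bsub>free_algebra R S\<^esub> monomial R b v = monomial R (a \<otimes> b) (u @ v)"
proof
  fix w :: "'g list"
  \<comment> \<open>Here \<open>u\<close> and \<open>v\<close> are bound and range over all
    factorizations of \<open>w\<close>, whereas in \<open>?t\<close> they are the two fixed
    words.\<close>
  let ?F = "{(u, v). u @ v = w}"
  let ?t = "\<lambda>p. monomial R a u (fst p) \<otimes> monomial R b v (snd p)"
  have t: "?t p = (if p = (u, v) then a \<otimes> b else \<zero>)" for p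
    using assms by (cases p) (auto simp: monomial_def)
  have "(\<Oplus>p\<in>?F. ?t p) = monomial R (a \<otimes> b) (u @ v) w"
  proof (cases "u @ v = w")
    case True
    then have "(\<Oplus>p\<in>?F. if p = (u, v) then a \<otimes> b else \<zero>) = a \<otimes> b"
      using assms by (intro add.finprod_singleton_swap finite_factorizations) auto
    then show ?thesis
      unfolding t using True by (simp add: monomial_def)
  next
    case False
    then have "(\<Oplus>p\<in>?F. ?t p) = \<zero>"
      by (intro add.finprod_one_eqI) (auto simp: t)
    then show ?thesis
      using False by (auto simp: monomial_def)
  qed
  then show "(monomial R a u \<otimes>\<^bsub>free_algebra R S\<^esub> monomial R b v) w =
      monomial R (a \<otimes> b) (u @ v) w"
    by (simp add: free_algebra_ops)
qed

section \<open>Ring axioms by reduction to monomials\<close>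

lemma free_algebra_l_one:
  assumes "x \<in> carrier (free_algebra R S)"
  shows "\<one>\<^bsub>free_algebra R S\<^esub> \<otimes>\<^bsub>free_algebra R S\<^esub> x = x"
  using assms
  by (induction rule: free_algebra_induct)
    (simp_all add: free_algebra_ops(1) word_basis_eq_monomial monomial_mult free_algebra_r_distr
      monomial_closed)

lemma free_algebra_r_one:
  assumes "x \<in> carrier (free_algebra R S)"
  shows "x \<otimes>\<^bsub>free_algebra R S\<^esub> \<one>\<^bsub>free_algebra R S\<^esub> = x"
  using assms
  by (induction rule: free_algebra_induct)
    (simp_all add: free_algebra_ops(1) word_basis_eq_monomial monomial_mult free_algebra_l_distr
      monomial_closed)

text \<open>Nested inductions on \<open>x\<close>, \<open>y\<close> and \<open>z\<close>:
  distributivity settles the sums, and on three monomials the claim is associativity in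
  \<open>R\<close> together with that of concatenation.\<close>

lemma free_algebra_assoc:
  assumes x: "x \<in> carrier (free_algebra R S)" and y: "y \<in> carrier (free_algebra R S)"
    and z: "z \<in> carrier (free_algebra R S)"
  shows "(x \<otimes>\<^bsub>free_algebra R S\<^esub> y) \<otimes>\<^bsub>free_algebra R S\<^esub> z =
    x \<otimes>\<^bsub>free_algebra R S\<^esub> (y \<otimes>\<^bsub>free_algebra R S\<^esub> z)"
  using x
proof (induction rule: free_algebra_induct)
  case x: (monomial a u)
  show ?case
    using y
  proof (induction rule: free_algebra_induct)
    case y: (monomial b v)
    show ?case
      using z
    proof (induction rule: free_algebra_induct)
      case (monomial c w)
      then show ?case
        using x y by (simp add: monomial_mult m_assoc)
    next
      case (add z z')
      then show ?case
        using x y by (simp add: free_algebra_r_distr free_algebra_mult_closed monomial_closed)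
    qed
  next
    case (add y y')
    then show ?case
      using x z by (simp add: free_algebra_l_distr free_algebra_r_distr free_algebra_mult_closed
          monomial_closed)
  qed
next
  case (add x x')
  then show ?case
    using y z by (simp add: free_algebra_l_distr free_algebra_mult_closed)
qed

lemma free_algebra_assoc_algebra: "assoc_algebra R (free_algebra R S)"
proof -
  interpret F: Module.module R "free_algebra R S"
    by (rule free_algebra_module)
  have one_closed: "\<one>\<^bsub>free_algebra R S\<^esub> \<in> carrier (free_algebra R S)"
    by (simp add: free_algebra_ops(1) word_basis_eq_monomial monomial_closed)
  have "ring (free_algebra R S)"
  proof (rule ringI)
    show "Group.monoid (free_algebra R S)"
      by (rule monoidI)
        (simp_all add: free_algebra_mult_closed free_algebra_assoc free_algebra_l_one
          free_algebra_r_one one_closed)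
  qed (auto intro: free_algebra_l_distr free_algebra_r_distr F.abelian_group_axioms)
  then show ?thesis
    by (intro assoc_algebra.intro F.module_axioms assoc_algebra_axioms.intro
        free_algebra_smult_mult_left free_algebra_smult_mult_right)
qed

end


section \<open>Linear extension of a map on words\<close>

text \<open>This has the shape of \<open>H_map\<close>, with an arbitrary target and arbitrary
  values \<open>b\<close> on words, so that the universal property can be shown apart from
  graphs.\<close>

definition linear_ext ::
    "('k, 'm) ring_scheme \<Rightarrow> ('k, 'a, 'p) module_scheme \<Rightarrow> ('g list \<Rightarrow> 'a) \<Rightarrow>
     ('g list \<Rightarrow> 'k) \<Rightarrow> 'a" where
  "linear_ext R M b x = (\<Oplus>\<^bsub>M\<^esub>w\<in>{w. x w \<noteq> \<zero>\<^bsub>R\<^esub>}. x w \<odot>\<^bsub>M\<^esub> b w)"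

context Module.module
begin

text \<open>Words outside the support contribute zero. This lets the extensions of elements with
  different supports be compared over one index set.\<close>

lemma linear_ext_superset:
  assumes "b \<in> lists S \<rightarrow> carrier M" "x \<in> carrier (free_algebra R S)"
    and "finite W" "W \<subseteq> lists S" "{w. x w \<noteq> \<zero>} \<subseteq> W"
  shows "linear_ext R M b x = (\<Oplus>\<^bsub>M\<^esub>w\<in>W. x w \<odot>\<^bsub>M\<^esub> b w)"
  unfolding linear_ext_def
proof (rule M.add.finprod_mono_neutral_cong_left)
  have bW: "b w \<in> carrier M" if "w \<in> W" for w
    using assms(1,4) that by blast
  show "(\<lambda>w. x w \<odot>\<^bsub>M\<^esub> b w) \<in> W \<rightarrow> carrier M"
    using bW assms(2) by auto
  show "x w \<odot>\<^bsub>M\<^esub> b w = \<zero>\<^bsub>M\<^esub>" if "w \<in> W - {w. x w \<noteq> \<zero>}" for w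
    using that bW by auto
qed (use assms in auto)

lemma linear_ext_closed:
  assumes "b \<in> lists S \<rightarrow> carrier M" "x \<in> carrier (free_algebra R S)"
  shows "linear_ext R M b x \<in> carrier M"
  unfolding linear_ext_def
  using assms by (intro M.finsum_closed) (force simp: free_algebra_carrier_iff)

lemma linear_ext_add:
  assumes b: "b \<in> lists S \<rightarrow> carrier M"
    and x: "x \<in> carrier (free_algebra R S)" and y: "y \<in> carrier (free_algebra R S)"
  shows "linear_ext R M b (x \<oplus>\<^bsub>free_algebra R S\<^esub> y) =
    linear_ext R M b x \<oplus>\<^bsub>M\<^esub> linear_ext R M b y"
proof -
  \<comment> \<open>The support of the sum can be smaller than this union because of cancellation,
    so all three sums are taken over the union.\<close>
  let ?W = "{w. x w \<noteq> \<zero>} \<union> {w. y w \<noteq> \<zero>}"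
  have W: "finite ?W" "?W \<subseteq> lists S"
    using x y by (auto simp: free_algebra_carrier_iff)
  have xy: "x \<oplus>\<^bsub>free_algebra R S\<^esub> y \<in> carrier (free_algebra R S)"
    using x y by (rule free_algebra_add_closed)
  have bW: "b w \<in> carrier M" if "w \<in> ?W" for w
    using b W(2) that by blast
  have "linear_ext R M b (x \<oplus>\<^bsub>free_algebra R S\<^esub> y) =
      (\<Oplus>\<^bsub>M\<^esub>w\<in>?W. (x \<oplus>\<^bsub>free_algebra R S\<^esub> y) w \<odot>\<^bsub>M\<^esub> b w)"
    using W xy by (intro linear_ext_superset[OF b]) (auto simp: free_algebra_ops)
  also have "\<dots> = (\<Oplus>\<^bsub>M\<^esub>w\<in>?W. x w \<odot>\<^bsub>M\<^esub> b w \<oplus>\<^bsub>M\<^esub> y w \<odot>\<^bsub>M\<^esub> b w)"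
    using bW x y
    by (intro M.finsum_cong') (auto simp: free_algebra_ops(3) smult_l_distr)
  also have "\<dots> = (\<Oplus>\<^bsub>M\<^esub>w\<in>?W. x w \<odot>\<^bsub>M\<^esub> b w) \<oplus>\<^bsub>M\<^esub> (\<Oplus>\<^bsub>M\<^esub>w\<in>?W. y w \<odot>\<^bsub>M\<^esub> b w)"
    using bW x y by (intro M.finsum_addf) auto
  also have "\<dots> = linear_ext R M b x \<oplus>\<^bsub>M\<^esub> linear_ext R M b y"
    using linear_ext_superset[OF b x W Un_upper1] linear_ext_superset[OF b y W Un_upper2] by simp
  finally show ?thesis .
qed

lemma linear_ext_monomial:
  assumes "b \<in> lists S \<rightarrow> carrier M" "a \<in> carrier R" "w \<in> lists S"
  shows "linear_ext R M b (monomial R a w) = a \<odot>\<^bsub>M\<^esub> b w"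
proof -
  \<comment> \<open>The support is empty when \<open>a = \<zero>\<close> and \<open>{w}\<close>
    otherwise; summing over \<open>{w}\<close> treats both cases alike.\<close>
  have "linear_ext R M b (monomial R a w) = (\<Oplus>\<^bsub>M\<^esub>u\<in>{w}. monomial R a w u \<odot>\<^bsub>M\<^esub> b u)"
    by (rule linear_ext_superset[OF assms(1) monomial_closed[OF assms(2,3)]])
      (use assms(3) in \<open>auto simp: monomial_def\<close>)
  also have "\<dots> = a \<odot>\<^bsub>M\<^esub> b w"
    using funcset_mem[OF assms(1,3)] assms(2) by (simp add: monomial_def)
  finally show ?thesis .
qed

text \<open>Scaling may annihilate coefficients and shrink the support. Induction avoids comparing
  supports, since on a monomial the scalar is absorbed into the coefficient.\<close>

lemma linear_ext_smult:
  assumes b: "b \<in> lists S \<rightarrow> carrier M" and a: "a \<in> carrier R"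
    and x: "x \<in> carrier (free_algebra R S)"
  shows "linear_ext R M b (a \<odot>\<^bsub>free_algebra R S\<^esub> x) = a \<odot>\<^bsub>M\<^esub> linear_ext R M b x"
  using x
proof (induction rule: free_algebra_induct)
  case (monomial c w)
  have "a \<odot>\<^bsub>free_algebra R S\<^esub> monomial R c w = monomial R (a \<otimes> c) w"
    using a by (auto simp: free_algebra_ops monomial_def)
  then show ?case
    using a b monomial funcset_mem[OF b monomial(2)]
    by (simp add: linear_ext_monomial smult_assoc1)
next
  case (add x y)
  interpret F: Module.module R "free_algebra R S"
    by (rule free_algebra_module)
  show ?case
    using a b add by (simp add: F.smult_r_distr linear_ext_add smult_r_distr linear_ext_closed)
qed

end

text \<open>This is the existence half of the universal property of the free algebra:
  \<open>b\<close> is a monoid homomorphism from words to the multiplicative monoid of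
  \<open>A\<close>. Both sides of the product rule are additive in each argument, so monomials
  suffice.\<close>

lemma (in assoc_algebra) linear_ext_algebra_morphism:
  assumes b: "b \<in> lists S \<rightarrow> carrier A"
    and b_Nil: "b [] = \<one>\<^bsub>A\<^esub>"
    and b_append: "\<And>u v. u \<in> lists S \<Longrightarrow> v \<in> lists S \<Longrightarrow> b (u @ v) = b u \<otimes>\<^bsub>A\<^esub> b v"
  shows "algebra_morphism R (free_algebra R S) A (linear_ext R A b)"
proof -
  interpret F: assoc_algebra R "free_algebra R S"
    by (rule free_algebra_assoc_algebra)
  have mult: "linear_ext R A b (x \<otimes>\<^bsub>free_algebra R S\<^esub> y) =
      linear_ext R A b x \<otimes>\<^bsub>A\<^esub> linear_ext R A b y"
    if x: "x \<in> carrier (free_algebra R S)" and y: "y \<in> carrier (free_algebra R S)" for x y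
    using x
  proof (induction rule: free_algebra_induct)
    case x: (monomial c u)
    show ?case
      using y
    proof (induction rule: free_algebra_induct)
      case y: (monomial d v)
      have uv: "b u \<in> carrier A" "b v \<in> carrier A"
        using b x y by auto
      \<comment> \<open>Bilinearity in \<open>A\<close> moves both scalars out; the product that
        remains is \<open>b (u @ v)\<close> by \<open>b_append\<close>.\<close>
      have "(c \<odot>\<^bsub>A\<^esub> b u) \<otimes>\<^bsub>A\<^esub> (d \<odot>\<^bsub>A\<^esub> b v) = (c \<otimes> d) \<odot>\<^bsub>A\<^esub> (b u \<otimes>\<^bsub>A\<^esub> b v)"
        using x y uv by (subst smult_mult_left) (simp_all add: smult_mult_right smult_assoc1)
      then show ?case
        using x y b by (simp add: monomial_mult linear_ext_monomial b_append)
    next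
      case (add y y')
      then show ?case
        using b x by (simp add: F.r_distr linear_ext_add r_distr linear_ext_closed
            monomial_closed)
    qed
  next
    case (add x x')
    then show ?case
      using b y by (simp add: F.l_distr linear_ext_add l_distr linear_ext_closed)
  qed
  have "linear_ext R A b \<one>\<^bsub>free_algebra R S\<^esub> = \<one>\<^bsub>A\<^esub>"
    using linear_ext_monomial[OF b, of \<one> "[]"]
    by (simp add: free_algebra_ops(1) word_basis_eq_monomial b_Nil)
  then have "linear_ext R A b \<in> ring_hom (free_algebra R S) A"
    using b mult by (intro ring_hom_memI) (auto intro: linear_ext_closed linear_ext_add)
  then show ?thesis
    using b by (simp add: algebra_morphism_def F.assoc_algebra_axioms assoc_algebra_axioms
        linear_ext_smult)
qed

section \<open>The morphism induced by a graph homomorphism\<close>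

theorem theorem3p12:
  fixes k :: "('k, 'm) ring_scheme"
    and G1 G2 :: "nat pair_pre_digraph"
    and f :: "nat \<Rightarrow> nat"
  assumes "cring k"
    and "connected_graph G1"
    and "connected_graph G2"
    and "f \<in> graph_hom G1 G2"
  shows "algebra_morphism k (H_alg k G1) (H_alg k G2) (H_map k G2 f)"
proof -
  interpret k: cring k
    by fact
  interpret H2: assoc_algebra k "H_alg k G2"
    unfolding H_alg_def by (rule k.free_algebra_assoc_algebra)
  let ?b = "\<lambda>w. word_basis k (map (graph_image f) w)"
  \<comment> \<open>This is the graph-theoretic input: words in the generators of the source go to
    words in the generators of the target, so \<open>?b\<close> takes values in the target
    algebra.\<close>
  have "map (graph_image f) w \<in> lists (connected_subgraphs G2)"
    if "w \<in> lists (connected_subgraphs G1)" for w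
    using that graph_image_connected_subgraphs[OF assms(3,4)] by auto
  then have "?b \<in> lists (connected_subgraphs G1) \<rightarrow> carrier (H_alg k G2)"
    by (auto simp: H_alg_def word_basis_eq_monomial intro!: k.monomial_closed)
  \<comment> \<open>\<open>?b\<close> is multiplicative because \<open>map\<close> respects
    \<open>[]\<close> and \<open>@\<close>, and basis elements multiply by concatenation of their
    words.\<close>
  then have "algebra_morphism k (free_algebra k (connected_subgraphs G1)) (H_alg k G2)
      (linear_ext k (H_alg k G2) ?b)"
    by (rule H2.linear_ext_algebra_morphism)
      (simp_all add: H_alg_def k.free_algebra_ops(1) word_basis_eq_monomial k.monomial_mult)
  moreover have "H_map k G2 f = linear_ext k (H_alg k G2) ?b"
    by (simp add: fun_eq_iff H_map_def linear_ext_def)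
  ultimately show ?thesis
    by (simp add: H_alg_def)
qed

end
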